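(* Consider a distributed gradient tracking instance given by a consensus matrix $W$ and local curvatures $h_1,\dots,h_N>0$ as described in the context, with essential spectral radius $\sigma$ of $W$ satisfying $\sigma\in(0,1)$ and curvature dispersion $\eta$ satisfying $\eta>0$. Then there exist a normalized stepsize $\beta\in(0,2)$ and a radius $r\in(R_0(\beta,\sigma),1)$ such that $\rho(A(\beta))<r$, where $A(\beta)$ is the reduced system matrix of the instance and $\rho(\cdot)$ denotes the spectral radius.
   Context: Setting. $\mathcal G=(\mathcal V,\mathcal E)$ is an undirected connected graph on $\mathcal V=\{1,\dots,N\}$ without self-loops. $W=[w_{ij}]\in\mathbb R^{N\times N}$ is symmetric and doubly stochastic, with $w_{ij}\in(0,1)$ if $(i,j)\in\mathcal E$ or $i=j$, and $w_{ij}=0$ otherwise. Its eigenvalues are $1=\lambda_1>\lambda_2\ge\cdots\ge\lambda_N>-1$, and its essential spectral radius is $\sigma:=\rho(W-\mathbf 1\mathbf 1^\top/N)=\max\{|\lambda_2|,|\lambda_N|\}<1$, where $\rho(\cdot)$ is the spectral radius. Local curvatures $h_i>0$, $i\in\mathcal V$, are given. The average curvature is $\bar h:=\frac1N\sum_i h_i$ and the curvature dispersion is $\eta:=\max_{i}|h_i-\bar h|/\bar h$. Put $D:=\operatorname{diag}(h_1/\bar h,\dots,h_N/\bar h)$ and $\Delta:=D-I$. Let $v:=\mathbf 1/\sqrt N$ and let $U\in\mathbb R^{N\times(N-1)}$ have as columns orthonormal eigenvectors of $W$ associated with $\lambda_2,\dots,\lambda_N$, so that $[v\ \ U]$ is orthogonal.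 Put $\Lambda:=\operatorname{diag}(\lambda_2,\dots,\lambda_N)$, $\delta:=U^\top\Delta v\in\mathbb R^{N-1}$, $\widetilde\Delta:=U^\top\Delta U$. For $\beta>0$ the reduced system matrix is the $(2N-1)\times(2N-1)$ matrix $$A(\beta)=\begin{bmatrix}1-\beta & \beta\delta^\top(\Lambda-I) & -\beta\delta^\top\Lambda\\ 0&\Lambda&-\Lambda\\ -\beta\delta&\beta(I+\widetilde\Delta)(\Lambda-I)&(I-\beta(I+\widetilde\Delta))\Lambda\end{bmatrix}.$$ For $\beta\in(0,2)$ and $\sigma\in[0,1)$ define $$R_+(\beta,\sigma):=\tfrac12\Big(\sigma(2-\beta)+\sqrt{\beta\sigma(4(1-\sigma)+\beta\sigma)}\Big),\quad R_-(\beta,\sigma):=\sqrt{\sigma(\sigma+\beta)},$$ $$R_T(\beta,\sigma):=\max\{R_+(\beta,\sigma),R_-(\beta,\sigma)\},\qquad R_0(\beta,\sigma):=\max\{|1-\beta|,R_T(\beta,\sigma)\}.$$ *)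

theory Defs
  imports
    "Jordan_Normal_Form.Spectral_Radius"
    "Graph_Theory.Digraph_Component"
begin

(* Agents are numbered 0, ..., N-1, the row and column indices of N x N matrices.
   A pair_graph is a finite symmetric loop-free digraph without parallel arcs, i.e. an undirected
   simple graph; connected includes that the vertex set is nonempty. *)

definition doubly_stochastic :: "nat \<Rightarrow> real mat \<Rightarrow> bool" where
  "doubly_stochastic N W \<longleftrightarrow>
     W \<in> carrier_mat N N \<and>
     (\<forall>i<N. \<forall>j<N. 0 \<le> W $$ (i, j)) \<and>
     (\<forall>i<N. (\<Sum>j<N. W $$ (i, j)) = 1) \<and>
     (\<forall>j<N. (\<Sum>i<N. W $$ (i, j)) = 1)"

definition consensus_matrix :: "nat \<Rightarrow> nat pair_pre_digraph \<Rightarrow> real mat \<Rightarrow> bool" where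
  "consensus_matrix N G W \<longleftrightarrow>
     pair_graph G \<and> pverts G = {..<N} \<and> Digraph_Component.connected (with_proj G) \<and>
     doubly_stochastic N W \<and> transpose_mat W = W \<and>
     (\<forall>i<N. \<forall>j<N.
        if (i, j) \<in> parcs G \<or> i = j then 0 < W $$ (i, j) \<and> W $$ (i, j) < 1
        else W $$ (i, j) = 0)"

definition spec_rad :: "real mat \<Rightarrow> real" where
  "spec_rad A = spectral_radius (map_mat complex_of_real A)"

definition ones_mat :: "nat \<Rightarrow> real mat" where
  "ones_mat N = mat N 1 (\<lambda>_. 1)"

definition ess_spec_rad :: "nat \<Rightarrow> real mat \<Rightarrow> real" where
  "ess_spec_rad N W =
     spec_rad (W - (1 / real N) \<cdot>\<^sub>m (ones_mat N * transpose_mat (ones_mat N)))"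

definition avg_curv :: "nat \<Rightarrow> (nat \<Rightarrow> real) \<Rightarrow> real" where
  "avg_curv N h = (\<Sum>i<N. h i) / real N"

definition curv_dispersion :: "nat \<Rightarrow> (nat \<Rightarrow> real) \<Rightarrow> real" where
  "curv_dispersion N h = Max ((\<lambda>i. \<bar>h i - avg_curv N h\<bar> / avg_curv N h) ` {..<N})"

(* Analogue of append_rows. *)
definition append_cols :: "real mat \<Rightarrow> real mat \<Rightarrow> real mat" (infixr \<open>@\<^sub>c\<close> 67) where
  "A @\<^sub>c B = four_block_mat A B (0\<^sub>m 0 (dim_col A)) (0\<^sub>m 0 (dim_col B))"

(* v = 1 / sqrt N, as an N x 1 matrix. *)
definition consensus_dir :: "nat \<Rightarrow> real mat" where
  "consensus_dir N = (1 / sqrt (real N)) \<cdot>\<^sub>m ones_mat N"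

(* The k-th largest eigenvalue (k = 1, ..., N, counted with multiplicity) is lam (k - 1);
   hence column j of U belongs to lam (Suc j). *)
definition spectral_basis :: "nat \<Rightarrow> real mat \<Rightarrow> (nat \<Rightarrow> real) \<Rightarrow> real mat \<Rightarrow> bool" where
  "spectral_basis N W lam U \<longleftrightarrow>
     char_poly W = (\<Prod>k<N. [:- lam k, 1:]) \<and>
     (\<forall>i j. i \<le> j \<longrightarrow> j < N \<longrightarrow> lam j \<le> lam i) \<and>
     U \<in> carrier_mat N (N - 1) \<and>
     (\<forall>j<N - 1. eigenvector W (col U j) (lam (Suc j))) \<and>
     transpose_mat (consensus_dir N @\<^sub>c U) * (consensus_dir N @\<^sub>c U) = 1\<^sub>m N"

definition Lambda_mat :: "nat \<Rightarrow> (nat \<Rightarrow> real) \<Rightarrow> real mat" where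
  "Lambda_mat N lam = mat_diag (N - 1) (\<lambda>j. lam (Suc j))"

definition Delta_mat :: "nat \<Rightarrow> (nat \<Rightarrow> real) \<Rightarrow> real mat" where
  "Delta_mat N h = mat_diag N (\<lambda>i. h i / avg_curv N h) - 1\<^sub>m N"

definition delta_mat :: "nat \<Rightarrow> (nat \<Rightarrow> real) \<Rightarrow> real mat \<Rightarrow> real mat" where
  "delta_mat N h U = transpose_mat U * Delta_mat N h * consensus_dir N"

definition reduced_Delta :: "nat \<Rightarrow> (nat \<Rightarrow> real) \<Rightarrow> real mat \<Rightarrow> real mat" where
  "reduced_Delta N h U = transpose_mat U * Delta_mat N h * U"

definition reduced_system ::
  "nat \<Rightarrow> (nat \<Rightarrow> real) \<Rightarrow> (nat \<Rightarrow> real) \<Rightarrow> real mat \<Rightarrow> real \<Rightarrow> real mat" where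
  "reduced_system N h lam U \<beta> =
     (let I = 1\<^sub>m (N - 1);
          L = Lambda_mat N lam;
          d = delta_mat N h U;
          K = I + reduced_Delta N h U
      in ((1 - \<beta>) \<cdot>\<^sub>m 1\<^sub>m 1 @\<^sub>c \<beta> \<cdot>\<^sub>m (transpose_mat d * (L - I)) @\<^sub>c - (\<beta> \<cdot>\<^sub>m (transpose_mat d * L)))
         @\<^sub>r
         (0\<^sub>m (N - 1) 1 @\<^sub>c L @\<^sub>c - L)
         @\<^sub>r
         (- (\<beta> \<cdot>\<^sub>m d) @\<^sub>c \<beta> \<cdot>\<^sub>m (K * (L - I)) @\<^sub>c (I - \<beta> \<cdot>\<^sub>m K) * L))"

definition R_plus :: "real \<Rightarrow> real \<Rightarrow> real" where
  "R_plus \<beta> \<sigma> =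
     1 / 2 * (\<sigma> * (2 - \<beta>) + sqrt (\<beta> * \<sigma> * (4 * (1 - \<sigma>) + \<beta> * \<sigma>)))"

definition R_minus :: "real \<Rightarrow> real \<Rightarrow> real" where
  "R_minus \<beta> \<sigma> = sqrt (\<sigma> * (\<sigma> + \<beta>))"

definition R_T :: "real \<Rightarrow> real \<Rightarrow> real" where
  "R_T \<beta> \<sigma> = max (R_plus \<beta> \<sigma>) (R_minus \<beta> \<sigma>)"

definition R_0 :: "real \<Rightarrow> real \<Rightarrow> real" where
  "R_0 \<beta> \<sigma> = max \<bar>1 - \<beta>\<bar> (R_T \<beta> \<sigma>)"

lemma reduced_system_carrier:
  assumes "U \<in> carrier_mat N (N - 1)" "0 < N"
  shows "reduced_system N h lam U \<beta> \<in> carrier_mat (2 * N - 1) (2 * N - 1)"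
  using assms
  by (auto simp: reduced_system_def Let_def append_rows_def append_cols_def Lambda_mat_def
      delta_mat_def reduced_Delta_def consensus_dir_def ones_mat_def Delta_mat_def mat_diag_def)

end

theory Submission
  imports Defs
begin

text \<open>For \<open>\<beta> \<rightarrow> 0\<close> the eigenvalue \<open>1\<close> of \<open>A(0)\<close> moves to \<open>1 - \<beta> + O(\<beta>\<^sup>2)\<close>, while the
  others stay near \<open>\<lambda>\<^sub>2, \<dots>, \<lambda>\<^sub>N\<close>, inside the unit disc. Quantitatively, if \<open>(x, y, w)\<close> is an
  eigenvector of \<open>A(\<beta>)\<close> for some \<open>z\<close> with \<open>\<bar>z\<bar> \<ge> 1\<close>, then \<open>z I - \<Lambda>\<close> is invertible, so the third
  block row gives \<open>\<parallel>w\<parallel> = O(\<beta> \<bar>x\<bar>)\<close> and the second one \<open>\<parallel>y\<parallel> = O(\<beta> \<bar>x\<bar>)\<close>; the first row then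
  yields \<open>\<bar>z - (1 - \<beta>)\<bar> = O(\<beta>\<^sup>2)\<close>, which contradicts \<open>\<bar>z\<bar> \<ge> 1\<close> for small \<open>\<beta>\<close>.
  Finally \<open>R\<^sub>0(\<beta>, \<sigma>) < 1\<close> for small \<open>\<beta>\<close>.\<close>

section \<open>Bounds on the radius \<open>R_0\<close>\<close>

lemma R_plus_less_1:
  assumes "0 < \<sigma>" "\<sigma> < 1" "0 < \<beta>"
  shows "R_plus \<beta> \<sigma> < 1"
proof -
  \<comment> \<open>The claim amounts to the square root being below
    \<open>2 - 2 * \<sigma> + \<sigma> * \<beta>\<close>, whose square exceeds the radicand by
    exactly \<open>4 * (1 - \<sigma>)\<^sup>2\<close>.\<close>
  have "0 < (1 - \<sigma>)\<^sup>2"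
    using assms by simp
  then have "\<beta> * \<sigma> * (4 * (1 - \<sigma>) + \<beta> * \<sigma>) < (2 - 2 * \<sigma> + \<sigma> * \<beta>)\<^sup>2"
    by (simp add: power2_eq_square algebra_simps)
  then have "sqrt (\<beta> * \<sigma> * (4 * (1 - \<sigma>) + \<beta> * \<sigma>)) < 2 - 2 * \<sigma> + \<sigma> * \<beta>"
    using assms by (intro real_less_lsqrt) auto
  then show ?thesis
    unfolding R_plus_def by (simp add: algebra_simps)
qed

lemma R_minus_less_1:
  assumes "0 < \<sigma>" "\<sigma> < 1" "\<beta> < 1 - \<sigma>"
  shows "R_minus \<beta> \<sigma> < 1"
proof -
  have "\<sigma> * (\<sigma> + \<beta>) < \<sigma> * 1"
    using assms by (intro mult_strict_left_mono) auto
  also have "\<dots> < 1"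
    using assms by simp
  finally show ?thesis
    by (simp add: R_minus_def)
qed

lemma R_0_less_1:
  assumes "0 < \<sigma>" "\<sigma> < 1" "0 < \<beta>" "\<beta> < 1 - \<sigma>"
  shows "R_0 \<beta> \<sigma> < 1"
  using R_plus_less_1[of \<sigma> \<beta>] R_minus_less_1[of \<sigma> \<beta>] assms by (simp add: R_0_def R_T_def)

section \<open>Perturbation estimate for the eigenvector equation\<close>

lemma norm_sum_mult_le:
  fixes a f :: "nat \<Rightarrow> complex"
  assumes "\<And>j. j < m \<Longrightarrow> norm (a j) \<le> M"
  shows "norm (\<Sum>j<m. a j * f j) \<le> M * (\<Sum>j<m. norm (f j))"
proof -
  have "norm (\<Sum>j<m. a j * f j) \<le> (\<Sum>j<m. norm (a j * f j))"
    by (rule norm_sum)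
  also have "\<dots> \<le> (\<Sum>j<m. M * norm (f j))"
    using assms by (intro sum_mono) (simp add: norm_mult mult_right_mono)
  finally show ?thesis
    by (simp add: sum_distrib_left)
qed

text \<open>Meant for the three block rows of the eigenvector equation with
  \<open>m = N - 1\<close>: \<open>p\<close>, \<open>q\<close>, \<open>d\<close>, \<open>P\<close>,
  \<open>Q\<close> collect the coefficients that the matrix multiplies by \<beta>, and
  \<open>lam\<close> is the shifted sequence of eigenvalues. The first smallness condition absorbs
  the feedback of \<open>y\<close> and \<open>w\<close> on \<open>w\<close>; the second makes their
  effect on the first row too weak to offset the decay factor \<open>1 - \<beta>\<close>.\<close>

lemma slow_mode_estimate:
  fixes z x :: complex and y w p q d :: "nat \<Rightarrow> complex" and P Q :: "nat \<Rightarrow> nat \<Rightarrow> complex"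
    and lam :: "nat \<Rightarrow> real" and \<beta> \<sigma> M :: real
  assumes \<sigma>: "0 \<le> \<sigma>" "\<sigma> < 1" and lam: "\<And>j. j < m \<Longrightarrow> \<bar>lam j\<bar> \<le> \<sigma>"
    and M: "0 < M"
    and bounds: "\<And>j. j < m \<Longrightarrow> norm (p j) \<le> M" "\<And>j. j < m \<Longrightarrow> norm (q j) \<le> M"
      "\<And>j. j < m \<Longrightarrow> norm (d j) \<le> M" "\<And>i j. i < m \<Longrightarrow> j < m \<Longrightarrow> norm (P i j) \<le> M"
      "\<And>i j. i < m \<Longrightarrow> j < m \<Longrightarrow> norm (Q i j) \<le> M"
    and x: "z * x = (1 - \<beta>) * x + \<beta> * ((\<Sum>j<m. p j * y j) + (\<Sum>j<m. q j * w j))"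
    and y: "\<And>i. i < m \<Longrightarrow> z * y i = lam i * y i - lam i * w i"
    and w: "\<And>i. i < m \<Longrightarrow>
      z * w i = lam i * w i + \<beta> * (d i * x + (\<Sum>j<m. P i j * y j) + (\<Sum>j<m. Q i j * w j))"
    and nz: "x \<noteq> 0 \<or> (\<exists>i<m. y i \<noteq> 0 \<or> w i \<noteq> 0)"
    and \<beta>: "0 < \<beta>" "\<beta> < 1" "4 * M * real m * \<beta> \<le> (1 - \<sigma>)\<^sup>2"
      "4 * M\<^sup>2 * real m * \<beta> < (1 - \<sigma>)\<^sup>2"
  shows "norm z < 1"
proof (rule ccontr)
  assume "\<not> norm z < 1"
  then have z: "1 \<le> norm z"
    by simp
  define s where "s = 1 - \<sigma>"
  have s: "0 < s" "s \<le> 1"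
    using \<sigma> by (auto simp: s_def)
  have \<beta>s: "4 * M * real m * \<beta> \<le> s\<^sup>2" "4 * M\<^sup>2 * real m * \<beta> < s\<^sup>2"
    using \<beta> by (auto simp: s_def)
  \<comment> \<open>Sizes are measured in the 1-norm, so entrywise bounds by \<open>M\<close>
    suffice and each sum over rows costs only a factor \<open>m\<close>.\<close>
  define X where "X = norm x"
  define Y where "Y = (\<Sum>j<m. norm (y j))"
  define V where "V = (\<Sum>j<m. norm (w j))"
  have nonneg: "0 \<le> X" "0 \<le> Y" "0 \<le> V"
    by (auto simp: X_def Y_def V_def sum_nonneg)
  \<comment> \<open>Quantitative invertibility of \<open>z I - \<Lambda>\<close>: each diagonal
    entry has modulus at least \<open>1 - \<sigma>\<close>, since \<open>z\<close> lies outside the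
    open unit disc.\<close>
  have gap: "s * norm u \<le> norm (z * u - lam i * u)" if "i < m" for i and u :: complex
  proof -
    have "s \<le> norm z - norm (complex_of_real (lam i))"
      using z lam[OF that] by (simp add: s_def)
    also have "\<dots> \<le> norm (z - lam i)"
      by (rule norm_triangle_ineq2)
    finally show ?thesis
      by (simp add: mult_right_mono norm_mult flip: left_diff_distrib)
  qed
  \<comment> \<open>Third block row, solved for \<open>w i\<close> through the gap.\<close>
  have "s * norm (w i) \<le> \<beta> * M * (X + Y + V)" if i: "i < m" for i
  proof -
    have "s * norm (w i) \<le> norm (z * w i - lam i * w i)"
      by (rule gap[OF i])
    also have "\<dots> = \<beta> * norm (d i * x + (\<Sum>j<m. P i j * y j) + (\<Sum>j<m. Q i j * w j))"
      using w[OF i] \<beta>(1) by (simp add: norm_mult)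
    also have "\<dots> \<le> \<beta> * (norm (d i * x) + norm (\<Sum>j<m. P i j * y j) + norm (\<Sum>j<m. Q i j * w j))"
      using \<beta>(1) by (intro mult_left_mono norm_triangle_le add_mono norm_triangle_ineq) auto
    also have "\<dots> \<le> \<beta> * (M * X + M * Y + M * V)"
      using \<beta>(1) bounds i unfolding Y_def V_def X_def
      by (intro mult_left_mono add_mono norm_sum_mult_le) (auto simp: norm_mult mult_right_mono)
    finally show ?thesis
      by (simp add: algebra_simps)
  qed
  then have "(\<Sum>i<m. s * norm (w i)) \<le> (\<Sum>i<m. \<beta> * M * (X + Y + V))"
    by (intro sum_mono) auto
  then have V1: "s * V \<le> real m * (\<beta> * M * (X + Y + V))"
    by (simp add: V_def sum_distrib_left)
  \<comment> \<open>Second block row: \<open>y\<close> is controlled by \<open>w\<close> alone,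
    without a factor \<beta>.\<close>
  have "s * norm (y i) \<le> norm (w i)" if i: "i < m" for i
  proof -
    have "s * norm (y i) \<le> norm (z * y i - lam i * y i)"
      by (rule gap[OF i])
    also have "\<dots> = \<bar>lam i\<bar> * norm (w i)"
      using y[OF i] by (simp add: norm_mult)
    also have "\<dots> \<le> 1 * norm (w i)"
      using lam[OF i] \<sigma> by (intro mult_right_mono) auto
    finally show ?thesis
      by simp
  qed
  then have "(\<Sum>i<m. s * norm (y i)) \<le> (\<Sum>i<m. norm (w i))"
    by (intro sum_mono) auto
  then have Y1: "s * Y \<le> V"
    by (simp add: V_def Y_def sum_distrib_left)
  have "s * V \<le> 1 * V"
    using s nonneg by (intro mult_right_mono) auto
  with Y1 have YV: "s * (Y + V) \<le> 2 * V"
    by (simp add: algebra_simps)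
  \<comment> \<open>Absorption: by the first smallness condition, the part of the right side of
    \<open>V1\<close> that contains \<open>Y + V\<close> is at most half of \<open>s * V\<close>,
    and only the part with \<open>X\<close> remains.\<close>
  have "4 * (real m * \<beta> * M * (Y + V)) \<le> s\<^sup>2 * (Y + V)"
    using mult_right_mono[OF \<beta>s(1), of "Y + V"] nonneg by (simp add: algebra_simps)
  also have "\<dots> \<le> s * (2 * V)"
    using mult_left_mono[OF YV, of s] s by (simp add: power2_eq_square algebra_simps)
  finally have "2 * (real m * \<beta> * M * (Y + V)) \<le> s * V"
    by (simp add: algebra_simps)
  with V1 have V2: "s * V \<le> 2 * (real m * \<beta> * M * X)"
    by (simp add: algebra_simps)
  have YV2: "s\<^sup>2 * (Y + V) \<le> 4 * (real m * \<beta> * M * X)"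
    using mult_left_mono[OF YV, of s] s V2 by (simp add: power2_eq_square algebra_simps)
  \<comment> \<open>If \<open>x\<close> vanished, \<open>YV2\<close> would force \<open>y\<close>
    and \<open>w\<close> to vanish too.\<close>
  have X: "0 < X"
  proof (rule ccontr)
    assume "\<not> 0 < X"
    with nonneg have X0: "X = 0"
      by simp
    with YV2 have "s\<^sup>2 * (Y + V) \<le> 0"
      by simp
    then have "Y + V \<le> 0"
      using s by (simp add: mult_le_0_iff)
    with nonneg have "Y = 0" "V = 0"
      by auto
    then have "\<forall>i<m. y i = 0 \<and> w i = 0"
      by (auto simp: Y_def V_def sum_nonneg_eq_0_iff)
    with X0 nz show False
      by (auto simp: X_def)
  qed
  let ?c = "(\<Sum>j<m. p j * y j) + (\<Sum>j<m. q j * w j)"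
  have "norm z * X = norm ((1 - \<beta>) * x + \<beta> * ?c)"
    by (simp only: X_def x flip: norm_mult)
  also have "\<dots> \<le> norm ((1 - \<beta>) * x) + norm (\<beta> * ?c)"
    by (rule norm_triangle_ineq)
  also have "\<dots> = norm ((1 - \<beta>) * x) + \<beta> * norm ?c"
    using \<beta>(1) by (simp add: norm_mult)
  also have "\<dots> \<le> (1 - \<beta>) * X + \<beta> * (M * Y + M * V)"
  proof (intro add_mono mult_left_mono order.trans[OF norm_triangle_ineq])
    show "norm ((1 - \<beta>) * x) \<le> (1 - \<beta>) * X"
      using \<beta> by (simp add: X_def norm_mult flip: of_real_diff)
  qed (use \<beta> bounds in \<open>auto simp: Y_def V_def intro!: norm_sum_mult_le\<close>)
  finally have "norm z * X \<le> (1 - \<beta>) * X + \<beta> * M * (Y + V)"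
    by (simp add: algebra_simps)
  moreover have "X \<le> norm z * X"
    using z nonneg by (simp add: mult_le_cancel_right1)
  ultimately have "\<beta> * X \<le> \<beta> * (M * (Y + V))"
    by (simp add: algebra_simps)
  \<comment> \<open>One factor \<beta> cancels, but by \<open>YV2\<close> the right side is still of
    order \<beta> times \<open>X\<close>; the second smallness condition then yields the
    contradiction.\<close>
  then have "X \<le> M * (Y + V)"
    using \<beta>(1) by simp
  then have "s\<^sup>2 * X \<le> M * (s\<^sup>2 * (Y + V))"
    using mult_left_mono[of X "M * (Y + V)" "s\<^sup>2"] by (simp add: algebra_simps)
  also have "\<dots> \<le> M * (4 * (real m * \<beta> * M * X))"
    using YV2 M by (intro mult_left_mono) auto
  also have "\<dots> = (4 * M\<^sup>2 * real m * \<beta>) * X"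
    by (simp add: power2_eq_square)
  also have "\<dots> < s\<^sup>2 * X"
    using \<beta>s(2) X by (intro mult_strict_right_mono)
  finally show False
    by simp
qed

section \<open>Spectral radius and the eigenvalues of \<open>W\<close> other than 1\<close>

lemma eigenvalue_norm_le_spec_rad:
  assumes A: "A \<in> carrier_mat n n" and ev: "eigenvector A v ev"
  shows "\<bar>ev\<bar> \<le> spec_rad A"
proof -
  let ?A = "map_mat complex_of_real A"
  have A': "?A \<in> carrier_mat n n"
    using A by simp
  have "eigenvalue ?A (complex_of_real ev)"
    using of_real_hom.eigenvalue_hom[OF A] ev by (auto simp: eigenvalue_def)
  then have mem: "norm (complex_of_real ev) \<in> norm ` spectrum ?A"
    unfolding spectrum_def by blast
  \<comment> \<open>A matrix of dimension 0 has empty spectrum, so the eigenvalue at hand excludes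
    this case.\<close>
  then have "n > 0"
    using card_finite_spectrum[OF A'] by (cases n) auto
  from spectral_radius_mem_max(2)[OF A' this mem] show ?thesis
    by (simp add: spec_rad_def)
qed

text \<open>In positive dimension the maximum defining the spectral radius is attained, so a strict
  bound on every eigenvalue stays strict.\<close>

lemma spec_rad_less:
  assumes A: "A \<in> carrier_mat n n" and n: "0 < n"
    and less: "\<And>z v. eigenvector (map_mat complex_of_real A) v z \<Longrightarrow> norm z < r"
  shows "spec_rad A < r"
proof -
  have "map_mat complex_of_real A \<in> carrier_mat n n"
    using A by simp
  from spectral_radius_mem_max(1)[OF this n] show ?thesis
    using less by (auto simp: spec_rad_def spectrum_def eigenvalue_def)
qed

text \<open>Orthogonality to the constant vector, read off entry \<open>(0, Suc j)\<close> of the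
  orthonormality relation: column 0 of the joined matrix is the consensus direction, and column
  \<open>j\<close> of \<open>U\<close> moves to position \<open>Suc j\<close>.\<close>

lemma spectral_basis_col_sum:
  assumes sb: "spectral_basis N W lam U" and j: "j < N - 1"
  shows "(\<Sum>i<N. U $$ (i, j)) = 0"
proof -
  let ?V = "consensus_dir N @\<^sub>c U"
  have U: "U \<in> carrier_mat N (N - 1)" and orth: "transpose_mat ?V * ?V = 1\<^sub>m N"
    using sb by (auto simp: spectral_basis_def)
  have cd: "consensus_dir N \<in> carrier_mat N 1"
    by (simp add: consensus_dir_def ones_mat_def)
  have V: "?V \<in> carrier_mat N N"
    using U cd j by (auto simp: append_cols_def)
  have V0: "?V $$ (i, 0) = 1 / sqrt (real N)" and VS: "?V $$ (i, Suc j) = U $$ (i, j)" if "i < N" for i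
    using that U cd j by (auto simp: append_cols_def consensus_dir_def ones_mat_def)
  have "(transpose_mat ?V * ?V) $$ (0, Suc j) = 0"
    using j by (simp add: orth)
  moreover have "(transpose_mat ?V * ?V) $$ (0, Suc j) = (\<Sum>i<N. ?V $$ (i, 0) * ?V $$ (i, Suc j))"
    using V j by (simp add: scalar_prod_def atLeast0LessThan)
  moreover have "\<dots> = (\<Sum>i<N. U $$ (i, j)) / sqrt (real N)"
    by (simp add: V0 VS sum_divide_distrib)
  ultimately show ?thesis
    using j by auto
qed

text \<open>The averaging matrix annihilates the columns of \<open>U\<close>, so they remain
  eigenvectors, with the same eigenvalues, after it is subtracted from \<open>W\<close>.\<close>

lemma spectral_basis_abs_le_ess_spec_rad:
  assumes sb: "spectral_basis N W lam U" and W: "W \<in> carrier_mat N N" and j: "j < N - 1"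
  shows "\<bar>lam (Suc j)\<bar> \<le> ess_spec_rad N W"
proof -
  let ?J = "(1 / real N) \<cdot>\<^sub>m (ones_mat N * transpose_mat (ones_mat N))"
  let ?u = "col U j"
  have U: "U \<in> carrier_mat N (N - 1)" and ev: "eigenvector W ?u (lam (Suc j))"
    using sb j by (auto simp: spectral_basis_def)
  have u: "?u \<in> carrier_vec N"
    using U by auto
  have J: "?J \<in> carrier_mat N N"
    unfolding ones_mat_def by auto
  have "?J *\<^sub>v ?u = 0\<^sub>v N"
  proof (rule eq_vecI)
    fix i assume "i < dim_vec (0\<^sub>v N :: real vec)"
    then have i: "i < N"
      by simp
    have "(?J *\<^sub>v ?u) $ i = (\<Sum>k<N. U $$ (k, j) / real N)"
      using U i j by (simp add: scalar_prod_def atLeast0LessThan ones_mat_def)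
    also have "\<dots> = 0"
      using spectral_basis_col_sum[OF sb j] by (simp flip: sum_divide_distrib)
    finally show "(?J *\<^sub>v ?u) $ i = (0\<^sub>v N) $ i"
      using i by simp
  qed (simp add: ones_mat_def)
  then have "(W - ?J) *\<^sub>v ?u = W *\<^sub>v ?u"
    using W u J by (subst minus_mult_distrib_mat_vec[OF W J u]) auto
  then have "eigenvector (W - ?J) ?u (lam (Suc j))"
    using ev W carrier_matD[OF J] by (simp add: eigenvector_def del: index_mult_mat index_smult_mat)
  then show ?thesis
    unfolding ess_spec_rad_def using W J by (intro eigenvalue_norm_le_spec_rad) auto
qed

section \<open>Entries of the reduced system matrix\<close>

lemma sum_lessThan_blocks:
  "(\<Sum>k<1 + m + m. f k) = f 0 + (\<Sum>k<m. f (1 + k)) + (\<Sum>k<m. f (1 + m + k :: nat) :: 'a :: comm_monoid_add)"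
proof -
  have split: "(\<Sum>k<a + b. g k) = (\<Sum>k<a. g k) + (\<Sum>k<b. g (a + k :: nat) :: 'a)" for a b g
    by (induction b) (auto simp: add.assoc)
  show ?thesis
    by (simp only: split) simp
qed

lemma sum_diag:
  assumes "i < (m :: nat)"
  shows "(\<Sum>j<m. complex_of_real (if i = j then c else 0) * f j) = c * f i"
  using assms by (subst sum.remove[of _ i]) auto

text \<open>Every entry is put in the form of a \<beta>-free part plus \<beta> times a \<beta>-free
  coefficient, apart from the corner \<open>1 - \<beta>\<close>. Signs are moved into the
  coefficient matrices so that these match the data of \<open>slow_mode_estimate\<close>.\<close>

lemma reduced_system_index:
  fixes h lam :: "nat \<Rightarrow> real" and U :: "real mat" and \<beta> :: real
  assumes U: "U \<in> carrier_mat N (N - 1)" and N: "0 < N"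
  defines "m \<equiv> N - 1" and "L \<equiv> Lambda_mat N lam" and "d \<equiv> delta_mat N h U"
    and "K \<equiv> 1\<^sub>m (N - 1) + reduced_Delta N h U"
    and "A \<equiv> reduced_system N h lam U \<beta>"
  shows "A $$ (0, 0) = 1 - \<beta>"
    and "j < m \<Longrightarrow> A $$ (0, 1 + j) = \<beta> * (transpose_mat d * (L - 1\<^sub>m m)) $$ (0, j)"
    and "j < m \<Longrightarrow> A $$ (0, 1 + m + j) = \<beta> * (- (transpose_mat d * L)) $$ (0, j)"
    and "i < m \<Longrightarrow> A $$ (1 + i, 0) = 0"
    and "i < m \<Longrightarrow> j < m \<Longrightarrow> A $$ (1 + i, 1 + j) = (if i = j then lam (Suc i) else 0)"
    and "i < m \<Longrightarrow> j < m \<Longrightarrow> A $$ (1 + i, 1 + m + j) = (if i = j then - lam (Suc i) else 0)"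
    and "i < m \<Longrightarrow> A $$ (1 + m + i, 0) = \<beta> * (- d) $$ (i, 0)"
    and "i < m \<Longrightarrow> j < m \<Longrightarrow> A $$ (1 + m + i, 1 + j) = \<beta> * (K * (L - 1\<^sub>m m)) $$ (i, j)"
    and "i < m \<Longrightarrow> j < m \<Longrightarrow>
      A $$ (1 + m + i, 1 + m + j) = (if i = j then lam (Suc i) else 0) + \<beta> * (- (K * L)) $$ (i, j)"
proof -
  have L: "L \<in> carrier_mat m m" and d: "d \<in> carrier_mat m 1" and K: "K \<in> carrier_mat m m"
    using U by (auto simp: L_def d_def K_def m_def Lambda_mat_def delta_mat_def reduced_Delta_def
        consensus_dir_def ones_mat_def mat_diag_def)
  have Lij: "L $$ (k, l) = (if k = l then lam (Suc k) else 0)" if "k < m" "l < m" for k l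
    using that by (simp add: L_def Lambda_mat_def mat_diag_def m_def)
  \<comment> \<open>Separates the unperturbed diagonal part of the last block from its
    perturbation.\<close>
  have "(1\<^sub>m m - \<beta> \<cdot>\<^sub>m K) * L = L - \<beta> \<cdot>\<^sub>m (K * L)"
    using K L by (subst minus_mult_distrib_mat[of _ m m]) auto
  then have A: "A =
      ((1 - \<beta>) \<cdot>\<^sub>m 1\<^sub>m 1 @\<^sub>c \<beta> \<cdot>\<^sub>m (transpose_mat d * (L - 1\<^sub>m m)) @\<^sub>c - (\<beta> \<cdot>\<^sub>m (transpose_mat d * L)))
         @\<^sub>r (0\<^sub>m m 1 @\<^sub>c L @\<^sub>c - L)
         @\<^sub>r (- (\<beta> \<cdot>\<^sub>m d) @\<^sub>c \<beta> \<cdot>\<^sub>m (K * (L - 1\<^sub>m m)) @\<^sub>c (L - \<beta> \<cdot>\<^sub>m (K * L)))"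
    unfolding A_def reduced_system_def Let_def L_def d_def K_def m_def by simp
  note dims = carrier_matD[OF L] carrier_matD[OF d] carrier_matD[OF K]
  show "A $$ (0, 0) = 1 - \<beta>"
    and "j < m \<Longrightarrow> A $$ (0, 1 + j) = \<beta> * (transpose_mat d * (L - 1\<^sub>m m)) $$ (0, j)"
    and "j < m \<Longrightarrow> A $$ (0, 1 + m + j) = \<beta> * (- (transpose_mat d * L)) $$ (0, j)"
    and "i < m \<Longrightarrow> A $$ (1 + i, 0) = 0"
    and "i < m \<Longrightarrow> j < m \<Longrightarrow> A $$ (1 + i, 1 + j) = (if i = j then lam (Suc i) else 0)"
    and "i < m \<Longrightarrow> j < m \<Longrightarrow> A $$ (1 + i, 1 + m + j) = (if i = j then - lam (Suc i) else 0)"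
    and "i < m \<Longrightarrow> A $$ (1 + m + i, 0) = \<beta> * (- d) $$ (i, 0)"
    and "i < m \<Longrightarrow> j < m \<Longrightarrow> A $$ (1 + m + i, 1 + j) = \<beta> * (K * (L - 1\<^sub>m m)) $$ (i, j)"
    and "i < m \<Longrightarrow> j < m \<Longrightarrow>
      A $$ (1 + m + i, 1 + m + j) = (if i = j then lam (Suc i) else 0) + \<beta> * (- (K * L)) $$ (i, j)"
    by (simp_all add: A append_rows_def append_cols_def dims Lij del: index_mult_mat(1))
qed

section \<open>Stability for all small stepsizes\<close>

lemma finite_square_bound:
  fixes f :: "nat \<Rightarrow> nat \<Rightarrow> real"
  obtains M where "0 < M" "\<And>i j. i < m \<Longrightarrow> j < m \<Longrightarrow> f i j \<le> M"
proof
  \<comment> \<open>The summand 1 added to \<open>?S\<close> keeps the bound positive even if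
    \<open>m = 0\<close>.\<close>
  let ?S = "\<Sum>(i, j)\<in>{..<m} \<times> {..<m}. \<bar>f i j\<bar>"
  show "0 < 1 + ?S"
    by (intro add_pos_nonneg sum_nonneg) auto
  show "f i j \<le> 1 + ?S" if "i < m" "j < m" for i j
    using member_le_sum[of "(i, j)" "{..<m} \<times> {..<m}" "\<lambda>(i, j). \<bar>f i j\<bar>"] that by auto
qed

text \<open>The coefficients of \<beta> do not depend on \<beta>, so a common bound \<open>M\<close>
  can be fixed first and the threshold for \<beta> computed from it.\<close>

lemma reduced_system_stable:
  assumes U: "U \<in> carrier_mat N (N - 1)" and N: "0 < N"
    and \<sigma>: "0 \<le> \<sigma>" "\<sigma> < 1" and lam: "\<And>j. j < N - 1 \<Longrightarrow> \<bar>lam (Suc j)\<bar> \<le> \<sigma>"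
  obtains \<beta>\<^sub>0 where "0 < \<beta>\<^sub>0" "\<And>\<beta>. 0 < \<beta> \<Longrightarrow> \<beta> < \<beta>\<^sub>0 \<Longrightarrow> spec_rad (reduced_system N h lam U \<beta>) < 1"
proof -
  define m where "m = N - 1"
  define L where "L = Lambda_mat N lam"
  define d where "d = delta_mat N h U"
  define K where "K = 1\<^sub>m (N - 1) + reduced_Delta N h U"
  note index = reduced_system_index[OF U N, where h = h and lam = lam, folded m_def L_def d_def K_def]
  let ?p = "\<lambda>j. (transpose_mat d * (L - 1\<^sub>m m)) $$ (0, j)"
  let ?q = "\<lambda>j. (- (transpose_mat d * L)) $$ (0, j)"
  let ?d = "\<lambda>i. (- d) $$ (i, 0)"
  let ?P = "\<lambda>i j. (K * (L - 1\<^sub>m m)) $$ (i, j)"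
  let ?Q = "\<lambda>i j. (- (K * L)) $$ (i, j)"
  \<comment> \<open>One bound serves all five families; the vectors are treated as arrays constant
    in \<open>i\<close>.\<close>
  obtain M where M: "0 < M" "\<And>i j. i < m \<Longrightarrow> j < m \<Longrightarrow>
      max \<bar>?p j\<bar> (max \<bar>?q j\<bar> (max \<bar>?d j\<bar> (max \<bar>?P i j\<bar> \<bar>?Q i j\<bar>))) \<le> M"
    using finite_square_bound[where m = m and
        f = "\<lambda>i j. max \<bar>?p j\<bar> (max \<bar>?q j\<bar> (max \<bar>?d j\<bar> (max \<bar>?P i j\<bar> \<bar>?Q i j\<bar>)))"]
    by metis
  have bnd: "\<bar>?p j\<bar> \<le> M" "\<bar>?q j\<bar> \<le> M" "\<bar>?d j\<bar> \<le> M" "\<bar>?P i j\<bar> \<le> M" "\<bar>?Q i j\<bar> \<le> M"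
    if "i < m" "j < m" for i j
    using M(2)[OF that] unfolding max.bounded_iff by blast+
  \<comment> \<open>The sum of both coefficients in the smallness conditions, so that
    \<open>c * \<beta> < (1 - \<sigma>)\<^sup>2\<close> implies each of them; the 1 makes
    \<open>c\<close> positive even if \<open>m = 0\<close>.\<close>
  define c where "c = 4 * M * real m + 4 * M\<^sup>2 * real m + 1"
  have c: "0 < c"
    using M(1) by (auto simp: c_def intro!: add_nonneg_pos)
  define \<beta>\<^sub>0 where "\<beta>\<^sub>0 = min 1 ((1 - \<sigma>)\<^sup>2 / c)"
  have "0 < \<beta>\<^sub>0"
    using c \<sigma> by (simp add: \<beta>\<^sub>0_def)
  moreover have "spec_rad (reduced_system N h lam U \<beta>) < 1" if \<beta>: "0 < \<beta>" "\<beta> < \<beta>\<^sub>0" for \<beta>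
  proof (rule spec_rad_less)
    have "c * \<beta> < (1 - \<sigma>)\<^sup>2"
      using \<beta> c by (simp add: \<beta>\<^sub>0_def pos_less_divide_eq mult.commute)
    moreover have "0 \<le> M * real m * \<beta>" "0 \<le> M\<^sup>2 * real m * \<beta>"
      using M \<beta> by auto
    ultimately have \<beta>': "4 * M * real m * \<beta> \<le> (1 - \<sigma>)\<^sup>2" "4 * M\<^sup>2 * real m * \<beta> < (1 - \<sigma>)\<^sup>2"
      using \<beta>(1) unfolding c_def distrib_right by linarith+
    let ?A = "reduced_system N h lam U \<beta>"
    \<comment> \<open>Both subtractions are truncated, so this relies on
      \<open>0 < N\<close>.\<close>
    have dim: "2 * N - 1 = 1 + m + m"
      using N by (simp add: m_def)
    show A: "?A \<in> carrier_mat (1 + m + m) (1 + m + m)"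
      using reduced_system_carrier[OF U N] unfolding dim .
    show "0 < 1 + m + m"
      by simp
    fix z u
    assume ev: "eigenvector (map_mat complex_of_real ?A) u z"
    then have u: "u \<in> carrier_vec (1 + m + m)" "u \<noteq> 0\<^sub>v (1 + m + m)"
      using A by (auto simp: eigenvector_def)
    define x where "x = u $ 0"
    define y where "y i = u $ (1 + i)" for i
    define w where "w i = u $ (1 + m + i)" for i
    have row: "z * u $ k = ?A $$ (k, 0) * x + (\<Sum>j<m. ?A $$ (k, 1 + j) * y j)
        + (\<Sum>j<m. ?A $$ (k, 1 + m + j) * w j)" if k: "k < 1 + m + m" for k
    proof -
      have "z * u $ k = (map_mat complex_of_real ?A *\<^sub>v u) $ k"
        using ev u k by (simp add: eigenvector_def)
      also have "\<dots> = (\<Sum>j<1 + m + m. complex_of_real (?A $$ (k, j)) * u $ j)"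
        using u A k by (simp add: scalar_prod_def atLeast0LessThan)
      finally show ?thesis
        unfolding sum_lessThan_blocks x_def y_def w_def .
    qed
    show "norm z < 1"
    proof (rule slow_mode_estimate[where m = m and \<sigma> = \<sigma> and M = M and \<beta> = \<beta> and x = x and y = y
          and w = w and lam = "\<lambda>i. lam (Suc i)" and p = "\<lambda>j. complex_of_real (?p j)"
          and q = "\<lambda>j. complex_of_real (?q j)" and d = "\<lambda>j. complex_of_real (?d j)"
          and P = "\<lambda>i j. complex_of_real (?P i j)" and Q = "\<lambda>i j. complex_of_real (?Q i j)"])
      show "z * x = (1 - \<beta>) * x + \<beta> * ((\<Sum>j<m. ?p j * y j) + (\<Sum>j<m. ?q j * w j))"
      proof -
        have "(\<Sum>j<m. ?A $$ (0, 1 + j) * y j) = \<beta> * (\<Sum>j<m. ?p j * y j)"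
          unfolding sum_distrib_left
          by (rule sum.cong) (simp_all only: lessThan_iff index of_real_mult mult.assoc)
        moreover have "(\<Sum>j<m. ?A $$ (0, 1 + m + j) * w j) = \<beta> * (\<Sum>j<m. ?q j * w j)"
          unfolding sum_distrib_left
          by (rule sum.cong) (simp_all only: lessThan_iff index of_real_mult mult.assoc)
        ultimately show ?thesis
          using row[of 0] by (simp only: index x_def[symmetric] distrib_left add.assoc)
      qed
      show "z * y i = lam (Suc i) * y i - lam (Suc i) * w i" if i: "i < m" for i
      proof -
        have "(\<Sum>j<m. ?A $$ (1 + i, 1 + j) * y j) = lam (Suc i) * y i"
          unfolding sum_diag[OF i, symmetric]
          by (rule sum.cong) (simp_all only: lessThan_iff index i)
        moreover have "(\<Sum>j<m. ?A $$ (1 + i, 1 + m + j) * w j) = (- lam (Suc i)) * w i"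
          unfolding sum_diag[OF i, symmetric]
          by (rule sum.cong) (simp_all only: lessThan_iff index i)
        ultimately show ?thesis
          using row[of "1 + i"] i by (simp only: index y_def[symmetric]) simp
      qed
      show "z * w i = lam (Suc i) * w i
          + \<beta> * (?d i * x + (\<Sum>j<m. ?P i j * y j) + (\<Sum>j<m. ?Q i j * w j))" if i: "i < m" for i
      proof -
        have "(\<Sum>j<m. ?A $$ (1 + m + i, 1 + j) * y j) = \<beta> * (\<Sum>j<m. ?P i j * y j)"
          unfolding sum_distrib_left
          by (rule sum.cong) (simp_all only: lessThan_iff index i of_real_mult mult.assoc)
        moreover have "(\<Sum>j<m. ?A $$ (1 + m + i, 1 + m + j) * w j)
            = lam (Suc i) * w i + \<beta> * (\<Sum>j<m. ?Q i j * w j)"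
          unfolding sum_diag[OF i, symmetric] sum_distrib_left sum.distrib[symmetric]
          by (rule sum.cong)
            (simp_all only: lessThan_iff index i of_real_mult of_real_add mult.assoc distrib_right)
        ultimately show ?thesis
          using row[of "1 + m + i"] i
          by (simp only: index w_def[symmetric] of_real_mult mult.assoc)
            (simp add: algebra_simps)
      qed
      show "x \<noteq> 0 \<or> (\<exists>i<m. y i \<noteq> 0 \<or> w i \<noteq> 0)"
      proof (rule ccontr)
        assume "\<not> ?thesis"
        then have zero: "x = 0" "\<And>i. i < m \<Longrightarrow> y i = 0" "\<And>i. i < m \<Longrightarrow> w i = 0"
          by auto
        \<comment> \<open>Positions 0, then 1 to \<open>m\<close>, then \<open>1 + m\<close> onwards
          exhaust \<open>u\<close>, which would therefore be the zero vector.\<close>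
        have "u $ k = 0" if "k < 1 + m + m" for k
        proof -
          consider "k = 0" | "0 < k" "k < 1 + m" | "1 + m \<le> k"
            by linarith
          then show ?thesis
            using zero(1) zero(2)[of "k - 1"] zero(3)[of "k - (1 + m)"] that
            by cases (auto simp: x_def y_def w_def)
        qed
        with u show False
          by (auto simp: vec_eq_iff)
      qed
      show "\<bar>lam (Suc j)\<bar> \<le> \<sigma>" if "j < m" for j
        using lam that by (simp add: m_def)
      show "\<beta> < 1"
        using \<beta>(2) by (simp add: \<beta>\<^sub>0_def)
    qed (fact \<sigma> M(1) \<beta>(1) \<beta>' | simp only: norm_of_real bnd)+
  qed
  ultimately show ?thesis
    by (rule that)
qed

section \<open>Choice of stepsize and radius\<close>

theorem theorem1:
  fixes N :: nat and G :: "nat pair_pre_digraph" and W U :: "real mat"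
    and h lam :: "nat \<Rightarrow> real" and \<sigma> \<eta> :: real
  assumes "consensus_matrix N G W"
    and "spectral_basis N W lam U"
    and "\<And>i. i < N \<Longrightarrow> 0 < h i"
    and "\<sigma> = ess_spec_rad N W" and "0 < \<sigma>" and "\<sigma> < 1"
    and "\<eta> = curv_dispersion N h" and "0 < \<eta>"
  shows "\<exists>\<beta> r. 0 < \<beta> \<and> \<beta> < 2 \<and> R_0 \<beta> \<sigma> < r \<and> r < 1 \<and>
           spec_rad (reduced_system N h lam U \<beta>) < r"
proof -
  have W: "W \<in> carrier_mat N N"
    using assms(1) by (simp add: consensus_matrix_def doubly_stochastic_def)
  have U: "U \<in> carrier_mat N (N - 1)"
    using assms(2) by (simp add: spectral_basis_def)
  have "pverts G = {..<N}" "Digraph_Component.connected (with_proj G)"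
    using assms(1) by (auto simp: consensus_matrix_def)
  \<comment> \<open>Connectedness includes a nonempty vertex set.\<close>
  then have N: "0 < N"
    by (cases N) (auto simp: connected_def strongly_connected_def)
  have "\<And>j. j < N - 1 \<Longrightarrow> \<bar>lam (Suc j)\<bar> \<le> \<sigma>"
    using spectral_basis_abs_le_ess_spec_rad[OF assms(2) W] assms(4) by simp
  then obtain \<beta>\<^sub>0 where \<beta>\<^sub>0: "0 < \<beta>\<^sub>0"
    "\<And>\<beta>. 0 < \<beta> \<Longrightarrow> \<beta> < \<beta>\<^sub>0 \<Longrightarrow> spec_rad (reduced_system N h lam U \<beta>) < 1"
    using reduced_system_stable[OF U N] assms(5,6) by (metis less_imp_le)
  \<comment> \<open>Below \<open>\<beta>\<^sub>0\<close> the matrix is stable; below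
    \<open>1 - \<sigma>\<close> the radius \<open>R_0\<close> is less than 1. The latter also gives
    \<open>\<beta> < 2\<close>.\<close>
  obtain \<beta> where \<beta>: "0 < \<beta>" "\<beta> < min \<beta>\<^sub>0 (1 - \<sigma>)"
    using dense[of 0 "min \<beta>\<^sub>0 (1 - \<sigma>)"] \<beta>\<^sub>0(1) assms(6) by auto
  then have "max (R_0 \<beta> \<sigma>) (spec_rad (reduced_system N h lam U \<beta>)) < 1"
    using \<beta>\<^sub>0(2)[of \<beta>] R_0_less_1[of \<sigma> \<beta>] assms(5,6) by simp
  \<comment> \<open>Both quantities are strictly below 1, so \<open>r\<close> fits between their
    maximum and 1.\<close>
  from dense[OF this] obtain r where
    "R_0 \<beta> \<sigma> < r" "spec_rad (reduced_system N h lam U \<beta>) < r" "r < 1"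
    by auto
  then show ?thesis
    using \<beta> assms(5) by (intro exI[of _ \<beta>] exI[of _ r]) auto
qed

end
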